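(* Let $\{\lambda_n\}_{n=1}^{\infty}$ be the sequence of points of the open unit disk $\mathbb{D}$ obtained by listing, group after group for $k=1,2,\dots$ and within the $k$-th group in the order $j=0,1,\dots,k-1$, the points $$\lambda_{k,j}=\left(1-\tfrac1k\right)e^{\frac{2\pi i j}{k}},\qquad j=0,\dots,k-1,\quad k=1,2,\dots,$$ that is, $\lambda_n=\lambda_{k,j}$ for $n=\frac{k(k-1)}{2}+j+1$. Let $K_{\lambda_n}(z)=(1-\overline{\lambda_n}z)^{-1}$ for $z\in\mathbb{D}$. Then the sequence $\{K_{\lambda_n}\}_{n=1}^{\infty}$ is a representing system for the Hardy space $H^2(\mathbb{D})$; that is, for every $f\in H^2(\mathbb{D})$ there are complex coefficients $x_n$, $n=1,2,\dots$, such that $$f=\sum_{n=1}^{\infty}x_nK_{\lambda_n},$$ with the series converging in the norm of $H^2(\mathbb{D})$.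
   Context: $\mathbb{D}$ is the open unit disk in $\mathbb{C}$. $H^2(\mathbb{D})$ is the Hardy space of analytic functions $f(z)=\sum_{n=0}^{\infty}c_nz^n$ on $\mathbb{D}$ with $\|f\|_{H^2}=\left(\sum_{n=0}^{\infty}|c_n|^2\right)^{1/2}<\infty$. The Szegő kernel is $K(z,\lambda)=(1-\overline{\lambda}z)^{-1}$, and $K_{\lambda}(\cdot)=K(\cdot,\lambda)$ for $\lambda\in\mathbb{D}$. A sequence $\{f_n\}_{n=1}^{\infty}$ in a Banach space $F$ is a representing system for $F$ if for every $f\in F$ there are scalars $x_n$, $n=1,2,\dots$, such that $f=\sum_{n=1}^{\infty}x_nf_n$ (convergence of the partial sums in the norm of $F$); the coefficients need not be unique. *)

theory Defs
  imports "HOL-Complex_Analysis.Complex_Analysis"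
begin

(* Elements of H^2 are represented by total functions of type complex => complex.
   Membership and norm depend only on the values on the open unit disk,
   so values outside the disk play no role. *)

definition hardy2 :: "(complex \<Rightarrow> complex) set" where
  "hardy2 = {f. f holomorphic_on ball 0 1 \<and>
                summable (\<lambda>n. (cmod (fps_nth (fps_expansion f 0) n))\<^sup>2)}"

(* Meaningful only for f in hardy2. *)
definition hardy2_norm :: "(complex \<Rightarrow> complex) \<Rightarrow> real" where
  "hardy2_norm f = sqrt (\<Sum>n. (cmod (fps_nth (fps_expansion f 0) n))\<^sup>2)"

definition szego_kernel :: "complex \<Rightarrow> complex \<Rightarrow> complex" where
  "szego_kernel l z = inverse (1 - cnj l * z)"

(* F is the carrier of a space of complex-valued functions and N its norm.
   Sequences are indexed from 1; the value g 0 is ignored. *)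
definition representing_system ::
  "('a \<Rightarrow> complex) set \<Rightarrow> (('a \<Rightarrow> complex) \<Rightarrow> real) \<Rightarrow> (nat \<Rightarrow> 'a \<Rightarrow> complex) \<Rightarrow> bool" where
  "representing_system F N g \<longleftrightarrow>
     (\<forall>n\<ge>1. g n \<in> F) \<and>
     (\<forall>f\<in>F. \<exists>x :: nat \<Rightarrow> complex.
        (\<lambda>m. N (\<lambda>z. f z - (\<Sum>n=1..m. x n * g n z))) \<longlonglongrightarrow> 0)"

end

theory Submission
  imports Defs
begin

text \<open>
  The series is built greedily, one group of points at a time. Identify a function in \<open>H\<^sup>2\<close> with its
  square-summable sequence \<open>a\<close> of Taylor coefficients; the kernel at \<open>l\<close> becomes the geometric sequence
  \<open>(cnj l) ^ n\<close>. It is enough to find absolute constants \<open>q < 1\<close> and \<open>C\<close> such that every \<open>f\<close> can be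
  approximated with error at most \<open>q * \<parallel>f\<parallel>\<close> by a combination of the kernels of a single group, chosen as
  late as desired, with all intermediate remainders bounded by \<open>C * \<parallel>f\<parallel>\<close>. Applying this to the
  remainder again and again makes the remainders at the ends of the chosen groups decay like \<open>q ^ i\<close>,
  and those in between are at most \<open>C\<close> times larger, so the whole series converges
  (\<open>representing_system_if_block_approximation\<close>).

  For the group on the circle of radius \<open>r = 1 - 1/k\<close>, put \<open>v = exp (- 2 \<pi> i / k)\<close>. The combination with
  coefficients \<open>c j\<close> has Taylor coefficients \<open>r ^ n * (\<Sum>j<k. c j * v ^ (j * n))\<close>, that is, a \<open>k\<close>-periodic
  discrete Fourier transform damped by \<open>r ^ n\<close>. By Fourier inversion the periodic factor can be
  prescribed on one period. Prescribing \<open>a n / r ^ n\<close> for \<open>n < D = k div 2\<close> and \<open>0\<close> on the rest of the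
  period reproduces the first \<open>D\<close> coefficients of \<open>f\<close> exactly. What remains is the tail of \<open>a\<close> beyond \<open>D\<close>,
  which is small for large \<open>k\<close>, and the damped copies of \<open>a 0, \<dots>, a (D - 1)\<close> in the later periods. Since
  \<open>r ^ k \<le> exp (- 1) \<le> 1/2\<close>, the copy in period \<open>l\<close> has squared norm at most \<open>(1/4) ^ l * \<parallel>a\<parallel>\<^sup>2\<close>, so all
  copies together have squared norm at most \<open>\<parallel>a\<parallel>\<^sup>2 / 3\<close>, and \<open>q = 3/4\<close> works.

  The partial sums within a group are controlled by the Parseval identity: truncating \<open>c\<close> only lowers
  its energy, which is at most \<open>4 * \<parallel>a\<parallel>\<^sup>2 / k\<close> because \<open>r ^ n \<ge> 1/2\<close> for \<open>n \<le> D\<close>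
  (\<open>l2norm_kernel_sum_le\<close>, \<open>block_approximation\<close>).
\<close>

section \<open>Representing systems from block approximation\<close>

text \<open>
  The greedy scheme. The bound by \<open>C\<close> on the intermediate remainders is what turns convergence along the
  ends of the chosen blocks into convergence of the full sequence of partial sums.
\<close>

lemma representing_system_if_block_approximation:
  fixes F :: "('a \<Rightarrow> complex) set" and N :: "('a \<Rightarrow> complex) \<Rightarrow> real"
  assumes q: "0 \<le> q" "q < 1" and C: "0 \<le> C"
    and g: "\<And>n. 1 \<le> n \<Longrightarrow> g n \<in> F"
    and nonneg: "\<And>f. f \<in> F \<Longrightarrow> 0 \<le> N f"
    and closed: "\<And>f A c. f \<in> F \<Longrightarrow> finite A \<Longrightarrow> 0 \<notin> A \<Longrightarrow> (\<lambda>z. f z - (\<Sum>n\<in>A. c n * g n z)) \<in> F"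
    and block: "\<And>f m. f \<in> F \<Longrightarrow> \<exists>s t c. m \<le> s \<and> s < t \<and>
      N (\<lambda>z. f z - (\<Sum>n\<in>{s<..t}. c n * g n z)) \<le> q * N f \<and>
      (\<forall>M\<le>t. N (\<lambda>z. f z - (\<Sum>n\<in>{s<..M}. c n * g n z)) \<le> C * N f)"
  shows "representing_system F N g"
  unfolding representing_system_def
proof (intro conjI ballI allI impI)
  fix f assume f: "f \<in> F"
  define R where "R = (\<lambda>x m z. f z - (\<Sum>n=1..m. x n * g n z))"
  have R_F: "R x m \<in> F" for x m
    unfolding R_def by (rule closed) (use f in auto)
  have R_cong: "R x m = R y m" if "\<And>n. n \<le> m \<Longrightarrow> x n = y n" for x y m
    unfolding R_def using that by (intro ext arg_cong2[where f="(-)"] sum.cong refl) auto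
  \<comment> \<open>A state of the recursion is an index \<open>m\<close> together with coefficients that are final up to \<open>m\<close>;
    \<open>Q\<close> says that a step keeps those and controls every partial sum on the way.\<close>
  define P where "P = (\<lambda>i (m, x). i \<le> m \<and> N (R x m) \<le> q ^ i * N f)"
  define Q where "Q = (\<lambda>i (m, x) (m', x'). m \<le> m' \<and> (\<forall>n\<le>m. x' n = x n) \<and>
     (\<forall>M. m \<le> M \<and> M \<le> m' \<longrightarrow> N (R x' M) \<le> C * (q ^ i * N f)))"
  have step: "\<exists>y. P (Suc i) y \<and> Q i st y" if "P i st" for i st
  proof -
    obtain m x where st: "st = (m, x)" by (cases st)
    with that have im: "i \<le> m" and Rm: "N (R x m) \<le> q ^ i * N f" by (auto simp: P_def)
    obtain s t c where s: "m \<le> s" "s < t"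
      and final: "N (\<lambda>z. R x m z - (\<Sum>n\<in>{s<..t}. c n * g n z)) \<le> q * N (R x m)"
      and part: "\<And>M. M \<le> t \<Longrightarrow> N (\<lambda>z. R x m z - (\<Sum>n\<in>{s<..M}. c n * g n z)) \<le> C * N (R x m)"
      using block[OF R_F, of m x m] by blast
    define x' where "x' = (\<lambda>n. if n \<le> m then x n else if n \<le> s then 0 else c n)"
    have R': "R x' M = (\<lambda>z. R x m z - (\<Sum>n\<in>{s<..M}. c n * g n z))" if "m \<le> M" for M
    proof
      fix z
      have "(\<Sum>n=1..M. x' n * g n z) = (\<Sum>n\<in>{1..m}. x' n * g n z) + (\<Sum>n\<in>{m<..M}. x' n * g n z)"
        using that by (subst sum.union_disjoint[symmetric]) (auto intro!: sum.cong)
      also have "(\<Sum>n\<in>{1..m}. x' n * g n z) = (\<Sum>n\<in>{1..m}. x n * g n z)"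
        by (intro sum.cong) (auto simp: x'_def)
      also have "(\<Sum>n\<in>{m<..M}. x' n * g n z) = (\<Sum>n\<in>{s<..M}. c n * g n z)"
        using s by (intro sum.mono_neutral_cong_right) (auto simp: x'_def)
      finally show "R x' M z = R x m z - (\<Sum>n\<in>{s<..M}. c n * g n z)"
        by (simp add: R_def)
    qed
    have "N (R x' t) \<le> q ^ Suc i * N f"
    proof -
      have "N (R x' t) \<le> q * N (R x m)" using final R'[of t] s by simp
      also have "\<dots> \<le> q * (q ^ i * N f)" by (intro mult_left_mono Rm q)
      finally show ?thesis by (simp add: mult.assoc)
    qed
    moreover have "N (R x' M) \<le> C * (q ^ i * N f)" if "m \<le> M" "M \<le> t" for M
    proof -
      have "N (R x' M) \<le> C * N (R x m)" using part R' that by simp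
      also have "\<dots> \<le> C * (q ^ i * N f)" by (intro mult_left_mono Rm C)
      finally show ?thesis .
    qed
    ultimately have "P (Suc i) (t, x') \<and> Q i st (t, x')"
      using s im by (auto simp: P_def Q_def st x'_def)
    then show ?thesis by blast
  qed
  have "P 0 (0, \<lambda>_. 0)" by (simp add: P_def R_def)
  then obtain h where h: "\<And>i. P i (h i)" "\<And>i. Q i (h i) (h (Suc i))"
    using dependent_nat_choice[of P Q] step by blast
  define m where "m = fst \<circ> h"
  define X where "X = snd \<circ> h"
  have h_eq: "h i = (m i, X i)" for i by (simp add: m_def X_def)
  have i_m: "i \<le> m i" for i using h(1)[of i] by (simp add: h_eq P_def)
  have m_Suc: "m i \<le> m (Suc i)" and X_Suc: "\<And>n. n \<le> m i \<Longrightarrow> X (Suc i) n = X i n"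
    and bound: "\<And>M. m i \<le> M \<Longrightarrow> M \<le> m (Suc i) \<Longrightarrow> N (R (X (Suc i)) M) \<le> C * (q ^ i * N f)" for i
    using h(2)[of i] by (auto simp: h_eq Q_def)
  have m_mono: "m i \<le> m j" if "i \<le> j" for i j
    using that m_Suc by (rule lift_Suc_mono_le[rotated])
  have X_stable: "X j n = X i n" if "i \<le> j" "n \<le> m i" for i j n
    using that
  proof (induction j rule: dec_induct)
    case (step l)
    then show ?case using X_Suc[of n l] m_mono[of i l] by simp
  qed simp
  \<comment> \<open>The diagonal is legitimate because \<open>i \<le> m i\<close>: the \<open>n\<close>-th coefficient is final from stage \<open>n\<close> on.\<close>
  define x where "x = (\<lambda>n. X n n)"
  have x_eq: "x n = X i n" if "n \<le> m i" for i n
    using X_stable[of n i n] X_stable[of i n n] i_m[of n] that nat_le_linear[of n i]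
    by (auto simp: x_def)
  have small: "N (R x M) \<le> C * (q ^ i * N f)" if "m i \<le> M" for i M
  proof -
    define j where "j = (LEAST j. M \<le> m (Suc j))"
    have ex: "M \<le> m (Suc M)" using i_m[of "Suc M"] by simp
    have jM: "M \<le> m (Suc j)" unfolding j_def by (rule LeastI[where P="\<lambda>j. M \<le> m (Suc j)", OF ex])
    have "\<exists>j\<ge>i. m j \<le> M \<and> M \<le> m (Suc j)"
    proof (cases "i \<le> j")
      case True
      have "m j \<le> M"
      proof (cases j)
        case 0
        with True that show ?thesis by simp
      next
        case (Suc l)
        then have "\<not> M \<le> m (Suc l)"
          using not_less_Least[of l "\<lambda>j. M \<le> m (Suc j)"] by (simp add: j_def)
        then show ?thesis using Suc by simp
      qed
      with True jM show ?thesis by blast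
    next
      case False
      then have "M \<le> m i" using jM m_mono[of "Suc j" i] by simp
      then show ?thesis using that m_Suc[of i] by (intro exI[of _ i]) auto
    qed
    then obtain j where j: "i \<le> j" "m j \<le> M" "M \<le> m (Suc j)" by blast
    have "R x M = R (X (Suc j)) M"
      by (rule R_cong) (use x_eq j in auto)
    then have "N (R x M) \<le> C * (q ^ j * N f)" using bound j by simp
    also have "\<dots> \<le> C * (q ^ i * N f)"
      by (intro mult_left_mono mult_right_mono C power_decreasing nonneg f) (use j q in auto)
    finally show ?thesis .
  qed
  have "(\<lambda>M. N (R x M)) \<longlonglongrightarrow> 0"
  proof (rule LIMSEQ_I)
    fix e :: real assume e: "0 < e"
    have "(\<lambda>i. C * (q ^ i * N f)) \<longlonglongrightarrow> C * (0 * N f)"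
      by (intro tendsto_intros LIMSEQ_power_zero) (use q in auto)
    then have "eventually (\<lambda>i. C * (q ^ i * N f) < e) sequentially"
      by (rule order_tendstoD(2)) (use e in simp)
    then obtain i where "C * (q ^ i * N f) < e" by (auto simp: eventually_sequentially)
    then have "norm (N (R x M) - 0) < e" if "m i \<le> M" for M
      using small[OF that] nonneg[OF R_F, of x M] by simp
    then show "\<exists>no. \<forall>n\<ge>no. norm (N (R x n) - 0) < e" by blast
  qed
  then show "\<exists>x. (\<lambda>m. N (\<lambda>z. f z - (\<Sum>n=1..m. x n * g n z))) \<longlonglongrightarrow> 0"
    unfolding R_def by blast
qed (use g in auto)

section \<open>Square-summable sequences\<close>

definition sq_summable :: "(nat \<Rightarrow> complex) \<Rightarrow> bool" where
  "sq_summable a \<longleftrightarrow> summable (\<lambda>n. (cmod (a n))\<^sup>2)"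

definition l2norm :: "(nat \<Rightarrow> complex) \<Rightarrow> real" where
  "l2norm a = sqrt (\<Sum>n. (cmod (a n))\<^sup>2)"

lemma l2norm_nonneg: "sq_summable a \<Longrightarrow> 0 \<le> l2norm a"
  unfolding l2norm_def sq_summable_def by (intro real_sqrt_ge_zero suminf_nonneg) auto

lemma l2norm_squared: "sq_summable a \<Longrightarrow> (l2norm a)\<^sup>2 = (\<Sum>n. (cmod (a n))\<^sup>2)"
  unfolding l2norm_def sq_summable_def by (intro real_sqrt_pow2 suminf_nonneg) auto

lemma L2_set_le_l2norm:
  assumes "sq_summable a"
  shows "L2_set (\<lambda>n. cmod (a n)) {..<m} \<le> l2norm a"
  using assms unfolding L2_set_def l2norm_def sq_summable_def
  by (intro real_sqrt_le_mono sum_le_suminf) auto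

text \<open>The finite sections determine the norm, so Minkowski's inequality passes from \<open>L2_set\<close> to sequences.\<close>

lemma l2norm_leI:
  assumes "\<And>m. L2_set (\<lambda>n. cmod (a n)) {..<m} \<le> B"
  shows "sq_summable a" "l2norm a \<le> B"
proof -
  have B: "0 \<le> B" using assms[of 0] by simp
  have le: "(\<Sum>n<m. (cmod (a n))\<^sup>2) \<le> B\<^sup>2" for m
    using assms[of m] unfolding L2_set_def by (rule sqrt_le_D)
  then show s: "sq_summable a"
    unfolding sq_summable_def by (intro summableI_nonneg_bounded) auto
  have "(\<Sum>n. (cmod (a n))\<^sup>2) \<le> B\<^sup>2"
    using s le unfolding sq_summable_def by (rule suminf_le_const)
  then show "l2norm a \<le> B" unfolding l2norm_def using B real_le_lsqrt by blast
qed

lemma l2norm_diff_le: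
  assumes "sq_summable a" "sq_summable b"
  shows "sq_summable (\<lambda>n. a n - b n)" "l2norm (\<lambda>n. a n - b n) \<le> l2norm a + l2norm b"
proof -
  have *: "L2_set (\<lambda>n. cmod (a n - b n)) {..<m} \<le> l2norm a + l2norm b" for m
  proof -
    have "L2_set (\<lambda>n. cmod (a n - b n)) {..<m} \<le> L2_set (\<lambda>n. cmod (a n) + cmod (b n)) {..<m}"
      by (intro L2_set_mono norm_triangle_ineq4) auto
    also have "\<dots> \<le> L2_set (\<lambda>n. cmod (a n)) {..<m} + L2_set (\<lambda>n. cmod (b n)) {..<m}"
      by (rule L2_set_triangle_ineq)
    also have "\<dots> \<le> l2norm a + l2norm b"
      by (intro add_mono L2_set_le_l2norm assms)
    finally show ?thesis .
  qed
  show "sq_summable (\<lambda>n. a n - b n)" by (rule l2norm_leI(1)) (rule *)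
  show "l2norm (\<lambda>n. a n - b n) \<le> l2norm a + l2norm b" by (rule l2norm_leI(2)) (rule *)
qed

lemma l2norm_le_if_squares_le:
  assumes "\<And>n. (cmod (a n))\<^sup>2 \<le> h n" "h sums s" "s \<le> B\<^sup>2" "0 \<le> B"
  shows "sq_summable a" "l2norm a \<le> B"
proof -
  show *: "sq_summable a" unfolding sq_summable_def
    by (rule summable_comparison_test'[OF sums_summable[OF assms(2)], of 0]) (use assms(1) in auto)
  have "(\<Sum>n. (cmod (a n))\<^sup>2) \<le> s"
    using * assms(1,2) unfolding sq_summable_def
    by (metis suminf_le sums_iff)
  then show "l2norm a \<le> B" unfolding l2norm_def using assms(3,4) by (intro real_le_lsqrt) auto
qed

lemma l2norm_tail_le:
  assumes a: "sq_summable a" and e: "0 < e"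
  shows "\<exists>D0. \<forall>D\<ge>D0. sq_summable (\<lambda>n. if n < D then 0 else a n) \<and>
    l2norm (\<lambda>n. if n < D then 0 else a n) \<le> e * l2norm a"
proof -
  let ?s = "\<Sum>n. (cmod (a n))\<^sup>2"
  have sums: "(\<lambda>n. (cmod (a n))\<^sup>2) sums ?s" and s0: "0 \<le> ?s"
    using a unfolding sq_summable_def by (auto intro: suminf_nonneg)
  have tail: "(\<lambda>n. if n < D then 0 else (cmod (a n))\<^sup>2) sums (?s - (\<Sum>n<D. (cmod (a n))\<^sup>2))" for D
    using sums_If_finite_set'[OF sums finite_lessThan[of D], of _ "\<lambda>_. 0"]
    by (simp add: sum_negf)
  have "\<exists>D0. \<forall>D\<ge>D0. ?s - (\<Sum>n<D. (cmod (a n))\<^sup>2) \<le> e\<^sup>2 * ?s"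
  proof (cases "?s = 0")
    case True
    then show ?thesis by (simp add: sum_nonneg)
  next
    case False
    then have pos: "0 < e\<^sup>2 * ?s" using s0 e by simp
    have "(\<lambda>D. ?s - (\<Sum>n<D. (cmod (a n))\<^sup>2)) \<longlonglongrightarrow> ?s - ?s"
      using sums unfolding sums_def by (intro tendsto_intros)
    then have "eventually (\<lambda>D. ?s - (\<Sum>n<D. (cmod (a n))\<^sup>2) < e\<^sup>2 * ?s) sequentially"
      by (rule order_tendstoD(2)) (use pos in simp)
    then show ?thesis by (auto simp: eventually_sequentially intro: less_imp_le)
  qed
  then obtain D0 where D0: "\<And>D. D0 \<le> D \<Longrightarrow> ?s - (\<Sum>n<D. (cmod (a n))\<^sup>2) \<le> (e * l2norm a)\<^sup>2"
    using l2norm_squared[OF a] by (auto simp: power_mult_distrib)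
  show ?thesis
  proof (intro exI allI impI)
    fix D assume D: "D0 \<le> D"
    have le: "(cmod (if n < D then 0 else a n))\<^sup>2 \<le> (if n < D then 0 else (cmod (a n))\<^sup>2)" for n
      by simp
    have nn: "0 \<le> e * l2norm a" using e l2norm_nonneg[OF a] by simp
    show "sq_summable (\<lambda>n. if n < D then 0 else a n) \<and>
        l2norm (\<lambda>n. if n < D then 0 else a n) \<le> e * l2norm a"
      using l2norm_le_if_squares_le[OF le tail D0[OF D] nn] by blast
  qed
qed

text \<open>
  A periodic sequence damped by \<open>p\<close> once per period: each period contributes the same sum, scaled by
  \<open>p ^ l\<close>. With \<open>p = 1/4\<close> this bounds the squared Taylor coefficients of combinations of kernels.
\<close>

lemma sums_geometric_periodic:
  fixes \<beta> :: "nat \<Rightarrow> real"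
  assumes k: "0 < k" and p: "0 \<le> p" "p < 1" and \<beta>: "\<And>i. 0 \<le> \<beta> i"
  shows "(\<lambda>n. p ^ (n div k) * \<beta> (n mod k)) sums ((\<Sum>i<k. \<beta> i) / (1 - p))"
proof -
  let ?f = "\<lambda>n. p ^ (n div k) * \<beta> (n mod k)" and ?S = "\<Sum>i<k. \<beta> i"
  have blk: "sum ?f {l * k..<l * k + k} = p ^ l * ?S" for l
  proof -
    have "sum ?f {l * k..<l * k + k} = (\<Sum>i<k. ?f (i + l * k))"
      using sum.shift_bounds_nat_ivl[of ?f 0 "l * k" k] by (simp add: add.commute lessThan_atLeast0)
    also have "\<dots> = (\<Sum>i<k. p ^ l * \<beta> i)" by (intro sum.cong) auto
    finally show ?thesis by (simp add: sum_distrib_left)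
  qed
  have geo: "(\<lambda>l. p ^ l * ?S) sums (?S / (1 - p))"
    using sums_mult2[OF geometric_sums[of p], of ?S] p by simp
  have S: "0 \<le> ?S" by (intro sum_nonneg \<beta>)
  have "summable ?f"
  proof (rule summableI_nonneg_bounded)
    show "0 \<le> ?f n" for n using p \<beta> by simp
    fix n
    have "sum ?f {..<n} \<le> sum ?f {..<n * k}"
      by (rule sum_mono2) (use p \<beta> k in \<open>auto intro: less_le_trans\<close>)
    also have "\<dots> = (\<Sum>l<n. p ^ l * ?S)" by (simp flip: sum.nat_group add: blk)
    also have "\<dots> \<le> (\<Sum>l. p ^ l * ?S)"
      by (rule sum_le_suminf) (use geo p S in \<open>auto simp: sums_iff\<close>)
    also have "\<dots> = ?S / (1 - p)" using geo by (simp add: sums_iff)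
    finally show "sum ?f {..<n} \<le> ?S / (1 - p)" .
  qed
  then have "(\<lambda>l. sum ?f {l * k..<l * k + k}) sums suminf ?f"
    by (intro sums_group summable_sums k)
  with geo have "suminf ?f = ?S / (1 - p)" by (simp add: blk sums_iff)
  with \<open>summable ?f\<close> show ?thesis by (simp add: sums_iff)
qed

lemma power_le_half_power_div:
  fixes r :: real
  assumes "0 \<le> r" "r \<le> 1" "r ^ k \<le> 1 / 2"
  shows "r ^ n \<le> (1 / 2) ^ (n div k)"
proof -
  have "r ^ n \<le> r ^ (k * (n div k))" by (intro power_decreasing assms) simp
  also have "\<dots> = (r ^ k) ^ (n div k)" by (simp add: power_mult)
  also have "\<dots> \<le> (1 / 2) ^ (n div k)" by (intro power_mono) (use assms in auto)
  finally show ?thesis .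
qed

section \<open>Discrete Fourier analysis\<close>

text \<open>Injectivity of \<open>i \<mapsto> v ^ i\<close> below \<open>k\<close> expresses that the \<open>k\<close>-th root of unity \<open>v\<close> is primitive.\<close>

context
  fixes k :: nat and v :: complex
  assumes k: "0 < k" and root: "v ^ k = 1" and inj: "inj_on (\<lambda>i. v ^ i) {..<k}"
begin

lemma cmod_root_unity: "cmod v = 1"
  using root k by (metis norm_one norm_power norm_ge_zero power_eq_1_iff gr_implies_not0)

lemma root_unity_power_mod: "v ^ (j * n) = v ^ (j * (n mod k))"
proof -
  have "v ^ n = v ^ (n mod k)"
    by (metis div_mult_mod_eq mult.commute mult_1 power_add power_mult power_one root)
  then show ?thesis by (metis mult.commute power_mult)
qed

text \<open>For \<open>i \<noteq> j\<close> this is a geometric sum whose ratio is a \<open>k\<close>-th root of unity other than \<open>1\<close>.\<close>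

lemma root_unity_orthogonality:
  assumes "i < k" "j < k"
  shows "(\<Sum>n<k. v ^ (i * n) * cnj (v ^ (j * n))) = (if i = j then of_nat k else 0)"
proof -
  define z where "z = v ^ i * cnj (v ^ j)"
  have unit: "v ^ l * cnj (v ^ l) = 1" for l
    by (simp add: complex_norm_square[symmetric] norm_power cmod_root_unity del: complex_cnj_power)
  have "v ^ (i * n) * cnj (v ^ (j * n)) = z ^ n" for n
    by (simp add: z_def power_mult power_mult_distrib)
  then have eq: "(\<Sum>n<k. v ^ (i * n) * cnj (v ^ (j * n))) = (\<Sum>n<k. z ^ n)" by simp
  show ?thesis
  proof (cases "i = j")
    case True
    then have "z = 1" using unit by (simp add: z_def)
    with True eq show ?thesis by simp
  next
    case False
    have "z \<noteq> 1"
    proof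
      assume "z = 1"
      then have "v ^ j = v ^ i * (v ^ j * cnj (v ^ j))"
        by (metis z_def mult.assoc mult.commute mult.right_neutral)
      then have "v ^ i = v ^ j" by (simp add: unit del: complex_cnj_power)
      with inj assms False show False by (auto dest: inj_onD)
    qed
    moreover have "z ^ k = (v ^ k) ^ i * cnj ((v ^ k) ^ j)"
      by (simp add: z_def power_mult_distrib flip: power_mult) (simp add: mult.commute)
    then have "z ^ k = 1" by (simp add: root)
    ultimately show ?thesis using False eq by (simp add: geometric_sum)
  qed
qed

lemma finite_parseval:
  "(\<Sum>n<k. (cmod (\<Sum>j<k. c j * v ^ (j * n)))\<^sup>2) = of_nat k * (\<Sum>j<k. (cmod (c j))\<^sup>2)"
proof -
  have "complex_of_real (\<Sum>n<k. (cmod (\<Sum>j<k. c j * v ^ (j * n)))\<^sup>2) =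
      (\<Sum>n<k. (\<Sum>i<k. c i * v ^ (i * n)) * cnj (\<Sum>j<k. c j * v ^ (j * n)))"
    by (simp only: of_real_sum complex_norm_square)
  also have "\<dots> = (\<Sum>n<k. \<Sum>i<k. \<Sum>j<k. c i * cnj (c j) * (v ^ (i * n) * cnj (v ^ (j * n))))"
    by (simp add: sum_product mult_ac)
  also have "\<dots> = (\<Sum>i<k. \<Sum>n<k. \<Sum>j<k. c i * cnj (c j) * (v ^ (i * n) * cnj (v ^ (j * n))))"
    by (rule sum.swap)
  also have "\<dots> = (\<Sum>i<k. \<Sum>j<k. \<Sum>n<k. c i * cnj (c j) * (v ^ (i * n) * cnj (v ^ (j * n))))"
    by (intro sum.cong refl sum.swap)
  also have "\<dots> = (\<Sum>i<k. \<Sum>j<k. c i * cnj (c j) * (if i = j then of_nat k else 0))"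
    by (intro sum.cong refl) (simp add: sum_distrib_left[symmetric] root_unity_orthogonality del: complex_cnj_power)
  also have "\<dots> = (\<Sum>i<k. of_nat k * (c i * cnj (c i)))"
    by (intro sum.cong refl) (simp add: if_distrib sum.delta cong: if_cong)
  also have "\<dots> = complex_of_real (of_nat k * (\<Sum>j<k. (cmod (c j))\<^sup>2))"
    by (simp only: of_real_mult of_real_sum of_real_of_nat_eq complex_norm_square sum_distrib_left)
  finally show ?thesis by (rule of_real_eq_iff[THEN iffD1])
qed

lemma finite_fourier_inversion:
  "(\<Sum>j<k. (\<Sum>m<k. b m * cnj (v ^ (m * j))) / of_nat k * v ^ (j * n)) = b (n mod k)"
proof -
  have "(\<Sum>j<k. (\<Sum>m<k. b m * cnj (v ^ (m * j))) / of_nat k * v ^ (j * n)) =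
      (\<Sum>j<k. \<Sum>m<k. b m / of_nat k * (v ^ (n mod k * j) * cnj (v ^ (m * j))))"
    by (simp only: root_unity_power_mod[of _ n] mult.commute[of _ "n mod k"] sum_distrib_right sum_divide_distrib) (simp add: mult_ac)
  also have "\<dots> = (\<Sum>m<k. b m / of_nat k * (\<Sum>j<k. v ^ (n mod k * j) * cnj (v ^ (m * j))))"
    by (subst sum.swap) (simp add: sum_distrib_left)
  also have "\<dots> = (\<Sum>m<k. if n mod k = m then b m else 0)"
    by (intro sum.cong refl, subst root_unity_orthogonality) (use k in auto)
  also have "\<dots> = b (n mod k)" using k by simp
  finally show ?thesis .
qed

text \<open>
  A Bessel-type bound for the kernels on one circle, uniform in the number \<open>M\<close> of terms. The Taylor
  coefficients are a periodic sequence damped by \<open>r ^ n\<close>; Parseval evaluates one period, and the damping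
  makes the remaining periods cost only the factor \<open>1 / (1 - 1/4) = 4/3\<close>.
\<close>

lemma l2norm_kernel_sum_le:
  fixes r :: real
  assumes r: "0 \<le> r" "r \<le> 1" "r ^ k \<le> 1 / 2" and M: "M \<le> k"
  shows "sq_summable (\<lambda>n. \<Sum>j<M. c j * (of_real r * v ^ j) ^ n)" (is "sq_summable ?u")
    and "(l2norm (\<lambda>n. \<Sum>j<M. c j * (of_real r * v ^ j) ^ n))\<^sup>2 \<le> 4 / 3 * (k * (\<Sum>j<k. (cmod (c j))\<^sup>2))"
proof -
  \<comment> \<open>Padding by zeros turns a partial sum into a full transform, to which Parseval applies.\<close>
  define d where "d = (\<lambda>j. if j < M then c j else 0)"
  define \<beta> where "\<beta> = (\<lambda>n. (cmod (\<Sum>j<k. d j * v ^ (j * n)))\<^sup>2)"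
  have u: "?u n = of_real (r ^ n) * (\<Sum>j<k. d j * v ^ (j * n))" for n
  proof -
    have "(\<Sum>j<k. d j * v ^ (j * n)) = (\<Sum>j<M. c j * v ^ (j * n))"
      using M by (intro sum.mono_neutral_cong_right) (auto simp: d_def)
    then show ?thesis
      by (simp add: sum_distrib_left power_mult_distrib power_mult mult_ac)
  qed
  have \<beta>_mod: "\<beta> n = \<beta> (n mod k)" for n
    unfolding \<beta>_def by (subst root_unity_power_mod) simp
  have le: "(cmod (?u n))\<^sup>2 \<le> (1/4) ^ (n div k) * \<beta> (n mod k)" for n
  proof -
    have "(cmod (?u n))\<^sup>2 = (r ^ n)\<^sup>2 * \<beta> n"
      using r by (simp only: u) (simp add: norm_mult power_mult_distrib \<beta>_def norm_power)
    also have "\<dots> \<le> ((1/2) ^ (n div k))\<^sup>2 * \<beta> n"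
      by (intro mult_right_mono power_mono power_le_half_power_div r) (use r in \<open>auto simp: \<beta>_def\<close>)
    also have "\<dots> = (1/4) ^ (n div k) * \<beta> (n mod k)"
      using \<beta>_mod[of n] by (simp add: power2_eq_square flip: power_mult_distrib)
    finally show ?thesis .
  qed
  have \<beta>0: "0 \<le> \<beta> i" for i by (simp add: \<beta>_def)
  have sums: "(\<lambda>n. (1/4) ^ (n div k) * \<beta> (n mod k)) sums (4 / 3 * (\<Sum>i<k. \<beta> i))"
    using sums_geometric_periodic[of k "1/4" \<beta>] k \<beta>0 by (simp add: mult.commute)
  have "(\<Sum>i<k. \<beta> i) = k * (\<Sum>j<k. (cmod (d j))\<^sup>2)"
    unfolding \<beta>_def by (rule finite_parseval)
  also have "\<dots> \<le> k * (\<Sum>j<k. (cmod (c j))\<^sup>2)"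
    by (intro mult_left_mono sum_mono) (auto simp: d_def)
  finally have S: "4 / 3 * (\<Sum>i<k. \<beta> i) \<le> 4 / 3 * (k * (\<Sum>j<k. (cmod (c j))\<^sup>2))"
    by simp
  let ?B = "4 / 3 * (k * (\<Sum>j<k. (cmod (c j))\<^sup>2))"
  have B: "0 \<le> ?B" by (intro mult_nonneg_nonneg sum_nonneg) auto
  have S': "4 / 3 * (\<Sum>i<k. \<beta> i) \<le> (sqrt ?B)\<^sup>2" using S B by (metis real_sqrt_pow2)
  note l2 = l2norm_le_if_squares_le[OF le sums S' real_sqrt_ge_zero[OF B]]
  show s: "sq_summable ?u" by (rule l2(1))
  show "(l2norm ?u)\<^sup>2 \<le> ?B"
    using power_mono[OF l2(2) l2norm_nonneg[OF s], of 2] B by simp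
qed

text \<open>
  The heart of the argument. The coefficients \<open>c\<close> are the inverse Fourier transform of \<open>b\<close>, which undoes
  the damping on the first \<open>D\<close> coefficients, so the combination agrees with \<open>a\<close> there and vanishes between
  \<open>D\<close> and \<open>k\<close>. The error is therefore the tail of \<open>a\<close> minus the copies \<open>w\<close> of \<open>a 0, \<dots>, a (D - 1)\<close> in later
  periods, of norm at most \<open>1/10 + 6/10\<close> relative to \<open>a\<close>, as \<open>1/3 \<le> (6/10)\<^sup>2\<close>. Taking \<open>D\<close> with
  \<open>r ^ D \<ge> 1/2\<close> keeps \<open>b\<close>, hence all partial sums, under control: \<open>4/3 * 4 \<le> 3\<^sup>2\<close> bounds them by
  \<open>3 * l2norm a\<close>, and their distance to \<open>a\<close> by \<open>4 * l2norm a\<close>.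
\<close>

lemma block_approximation:
  fixes r :: real
  assumes a: "sq_summable a"
    and r: "0 < r" "r \<le> 1" "r ^ k \<le> 1 / 2" and D: "D \<le> k" "1 / 2 \<le> r ^ D"
    and tail: "sq_summable (\<lambda>n. if n < D then 0 else a n)"
      "l2norm (\<lambda>n. if n < D then 0 else a n) \<le> 1 / 10 * l2norm a"
  shows "\<exists>c. l2norm (\<lambda>n. a n - (\<Sum>j<k. c j * (of_real r * v ^ j) ^ n)) \<le> 3 / 4 * l2norm a \<and>
    (\<forall>M\<le>k. l2norm (\<lambda>n. a n - (\<Sum>j<M. c j * (of_real r * v ^ j) ^ n)) \<le> 4 * l2norm a)"
proof -
  define b where "b = (\<lambda>m. if m < D then a m / of_real (r ^ m) else 0)"
  define c where "c = (\<lambda>j. (\<Sum>m<k. b m * cnj (v ^ (m * j))) / of_nat k)"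
  have a0: "0 \<le> l2norm a" by (rule l2norm_nonneg[OF a])
  have low: "(\<Sum>m<D. (cmod (a m))\<^sup>2) \<le> (l2norm a)\<^sup>2"
    unfolding l2norm_squared[OF a] using a unfolding sq_summable_def
    by (intro sum_le_suminf) auto
  have c_energy: "k * (\<Sum>j<k. (cmod (c j))\<^sup>2) \<le> 4 * (l2norm a)\<^sup>2"
  proof -
    \<comment> \<open>Conjugation makes \<open>c\<close> a transform in \<open>v\<close> itself, the form in which Parseval is available.\<close>
    have "(cmod (c j))\<^sup>2 = (cmod (\<Sum>m<k. cnj (b m) * v ^ (m * j)))\<^sup>2 / (real k)\<^sup>2" for j
    proof -
      have "cmod (\<Sum>m<k. b m * cnj (v ^ (m * j))) = cmod (cnj (\<Sum>m<k. b m * cnj (v ^ (m * j))))"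
        by (rule complex_mod_cnj[symmetric])
      then show ?thesis by (simp add: c_def norm_divide power_divide)
    qed
    then have "k * (\<Sum>j<k. (cmod (c j))\<^sup>2) =
        k * ((\<Sum>j<k. (cmod (\<Sum>m<k. cnj (b m) * v ^ (m * j)))\<^sup>2) / (real k)\<^sup>2)"
      by (simp add: sum_divide_distrib)
    also have "\<dots> = (\<Sum>m<k. (cmod (b m))\<^sup>2)"
      using k by (subst finite_parseval) (simp add: power2_eq_square)
    also have "\<dots> = (\<Sum>m<D. (cmod (b m))\<^sup>2)"
      using D by (intro sum.mono_neutral_cong_right) (auto simp: b_def)
    also have "\<dots> \<le> (\<Sum>m<D. 4 * (cmod (a m))\<^sup>2)"
    proof (rule sum_mono)
      fix m assume "m \<in> {..<D}"
      then have m: "m < D" by simp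
      have "r ^ D \<le> r ^ m" using m r by (intro power_decreasing) auto
      then have "1 / 2 \<le> r ^ m" using D by simp
      then have "cmod (a m) / r ^ m \<le> cmod (a m) / (1 / 2)"
        by (intro divide_left_mono) auto
      then have "cmod (b m) \<le> 2 * cmod (a m)"
        using m r by (simp add: b_def norm_divide norm_power)
      then have "(cmod (b m))\<^sup>2 \<le> (2 * cmod (a m))\<^sup>2" by (intro power_mono) auto
      then show "(cmod (b m))\<^sup>2 \<le> 4 * (cmod (a m))\<^sup>2" by (simp add: power_mult_distrib)
    qed
    also have "\<dots> \<le> 4 * (l2norm a)\<^sup>2" using low by (simp flip: sum_distrib_left)
    finally show ?thesis .
  qed
  have "l2norm (\<lambda>n. a n - (\<Sum>j<M. c j * (of_real r * v ^ j) ^ n)) \<le> 4 * l2norm a" if M: "M \<le> k" for M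
  proof -
    let ?u = "\<lambda>n. \<Sum>j<M. c j * (of_real r * v ^ j) ^ n"
    note u = l2norm_kernel_sum_le[OF less_imp_le[OF r(1)] r(2,3) M, of c]
    have "(l2norm ?u)\<^sup>2 \<le> 4 / 3 * (4 * (l2norm a)\<^sup>2)" using u(2) c_energy by linarith
    also have "\<dots> \<le> (3 * l2norm a)\<^sup>2" by (simp add: power_mult_distrib)
    finally have "l2norm ?u \<le> 3 * l2norm a" by (rule power2_le_imp_le) (use a0 in simp)
    then show ?thesis using l2norm_diff_le(2)[OF a u(1)] by simp
  qed
  moreover have "l2norm (\<lambda>n. a n - (\<Sum>j<k. c j * (of_real r * v ^ j) ^ n)) \<le> 3 / 4 * l2norm a"
  proof -
    define w where "w = (\<lambda>n. if n < k then 0 else of_real (r ^ n) * b (n mod k))"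
    define \<beta> where "\<beta> = (\<lambda>m. if m < D then (cmod (a m))\<^sup>2 else 0)"
    have sum_eq: "(\<Sum>j<k. c j * (of_real r * v ^ j) ^ n) = of_real (r ^ n) * b (n mod k)" for n
    proof -
      have "(\<Sum>j<k. c j * (of_real r * v ^ j) ^ n) = of_real (r ^ n) * (\<Sum>j<k. c j * v ^ (j * n))"
        by (simp add: sum_distrib_left power_mult_distrib power_mult mult_ac)
      then show ?thesis unfolding c_def finite_fourier_inversion .
    qed
    have err: "a n - (\<Sum>j<k. c j * (of_real r * v ^ j) ^ n) = (if n < D then 0 else a n) - w n" for n
      unfolding sum_eq using D r by (auto simp: w_def b_def)
    have le: "(cmod (w n))\<^sup>2 \<le> (if n \<in> {..<k} then 0 else (1/4) ^ (n div k) * \<beta> (n mod k))" for n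
    proof (cases "k \<le> n \<and> n mod k < D")
      case True
      have "r ^ n = r ^ (n div k * k) * r ^ (n mod k)" by (simp flip: power_add)
      then have "w n = of_real (r ^ (n div k * k)) * a (n mod k)"
        using True r by (simp add: w_def b_def)
      then have "(cmod (w n))\<^sup>2 = (r ^ (n div k * k))\<^sup>2 * \<beta> (n mod k)"
        using True r by (simp add: \<beta>_def norm_mult norm_power power_mult_distrib)
      also have "\<dots> \<le> ((1/2) ^ (n div k))\<^sup>2 * \<beta> (n mod k)"
        using power_le_half_power_div[of r k "n div k * k"] r k
        by (intro mult_right_mono power_mono) (auto simp: \<beta>_def)
      also have "\<dots> = (1/4) ^ (n div k) * \<beta> (n mod k)"
        by (simp add: power2_eq_square flip: power_mult_distrib)
      finally show ?thesis using True by simp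
    qed (auto simp: w_def b_def \<beta>_def)
    have "(\<Sum>m<k. \<beta> m) = (\<Sum>m<D. (cmod (a m))\<^sup>2)"
      using D by (intro sum.mono_neutral_cong_right) (auto simp: \<beta>_def)
    then have \<beta>_le: "(\<Sum>m<k. \<beta> m) \<le> (l2norm a)\<^sup>2" using low by simp
    have "(\<lambda>n. (1/4) ^ (n div k) * \<beta> (n mod k)) sums ((\<Sum>m<k. \<beta> m) / (1 - 1/4))"
      by (rule sums_geometric_periodic) (use k in \<open>auto simp: \<beta>_def\<close>)
    from sums_If_finite_set'[OF this finite_lessThan[of k] refl, of "\<lambda>_. 0"]
    have sums: "(\<lambda>n. if n \<in> {..<k} then 0 else (1/4) ^ (n div k) * \<beta> (n mod k)) sums (1/3 * (\<Sum>m<k. \<beta> m))"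
      by (simp add: sum_negf)
    have "1/3 * (\<Sum>m<k. \<beta> m) \<le> (6/10 * l2norm a)\<^sup>2"
    proof -
      have "(6/10 * l2norm a)\<^sup>2 = 36/100 * (l2norm a)\<^sup>2" by (simp add: power_mult_distrib power_divide)
      then show ?thesis using \<beta>_le zero_le_power2[of "l2norm a"] by linarith
    qed
    from l2norm_le_if_squares_le[OF le sums this]
    have w: "sq_summable w" "l2norm w \<le> 6/10 * l2norm a" using a0 by auto
    show ?thesis unfolding err using l2norm_diff_le(2)[OF tail(1) w(1)] tail(2) w(2) a0 by linarith
  qed
  ultimately show ?thesis by blast
qed

end

section \<open>The Hardy space in terms of Taylor coefficients\<close>

abbreviation taylor :: "(complex \<Rightarrow> complex) \<Rightarrow> nat \<Rightarrow> complex" where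
  "taylor f \<equiv> fps_nth (fps_expansion f 0)"

lemma hardy2_iff: "f \<in> hardy2 \<longleftrightarrow> f holomorphic_on ball 0 1 \<and> sq_summable (taylor f)"
  by (simp add: hardy2_def sq_summable_def)

lemma hardy2_norm_eq_l2norm: "hardy2_norm f = l2norm (taylor f)"
  by (simp add: hardy2_norm_def l2norm_def)

lemma has_fps_expansion_szego_kernel: "szego_kernel l has_fps_expansion Abs_fps (\<lambda>n. cnj l ^ n)"
proof -
  have "(\<lambda>z. inverse (1 - cnj l * z)) has_fps_expansion inverse (1 - fps_const (cnj l) * fps_X)"
    by (intro fps_expansion_intros) auto
  also have "inverse (1 - fps_const (cnj l) * fps_X) = Abs_fps (\<lambda>n. cnj l ^ n)"
  proof (rule fps_inverse_unique)
    have "(1 - fps_const (cnj l) * fps_X) * Abs_fps (\<lambda>n. cnj l ^ n) =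
        Abs_fps (\<lambda>n. cnj l ^ n) - fps_const (cnj l) * (fps_X * Abs_fps (\<lambda>n. cnj l ^ n))"
      by (simp add: algebra_simps)
    also have "\<dots> = 1"
    proof (rule fps_ext)
      fix n
      show "fps_nth (Abs_fps (\<lambda>n. cnj l ^ n) - fps_const (cnj l) * (fps_X * Abs_fps (\<lambda>n. cnj l ^ n))) n =
          fps_nth 1 n"
        by (cases n) auto
    qed
    finally show "(1 - fps_const (cnj l) * fps_X) * Abs_fps (\<lambda>n. cnj l ^ n) = 1" .
  qed
  finally show ?thesis by (simp add: szego_kernel_def[abs_def])
qed

lemma holomorphic_on_szego_kernel: "cmod l < 1 \<Longrightarrow> szego_kernel l holomorphic_on ball 0 1"
  unfolding szego_kernel_def
proof (intro holomorphic_intros)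
  fix z :: complex assume "cmod l < 1" "z \<in> ball 0 1"
  then have "cmod l * cmod z \<le> cmod l" by (intro mult_left_le) auto
  with \<open>cmod l < 1\<close> have "cmod (cnj l * z) < 1" by (simp add: norm_mult)
  then show "1 - cnj l * z \<noteq> 0" by auto
qed

lemma taylor_diff_szego_sum:
  assumes "f holomorphic_on ball 0 1"
  shows "taylor (\<lambda>z. f z - (\<Sum>n\<in>A. c n * szego_kernel (l n) z)) =
    (\<lambda>i. taylor f i - (\<Sum>n\<in>A. c n * cnj (l n) ^ i))"
proof -
  have "f has_fps_expansion fps_expansion f 0"
    using assms by (intro has_fps_expansion_fps_expansion[of "ball 0 1"]) auto
  then have "(\<lambda>z. f z - (\<Sum>n\<in>A. c n * szego_kernel (l n) z)) has_fps_expansion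
      fps_expansion f 0 - (\<Sum>n\<in>A. fps_const (c n) * Abs_fps (\<lambda>i. cnj (l n) ^ i))"
    by (intro fps_expansion_intros has_fps_expansion_szego_kernel)
  then have "fps_expansion (\<lambda>z. f z - (\<Sum>n\<in>A. c n * szego_kernel (l n) z)) 0 =
      fps_expansion f 0 - (\<Sum>n\<in>A. fps_const (c n) * Abs_fps (\<lambda>i. cnj (l n) ^ i))"
    by (rule fps_expansion_eqI)
  then show ?thesis by (simp add: fps_sum_nth fun_eq_iff)
qed

lemma sq_summable_power:
  assumes "cmod x < 1"
  shows "sq_summable (\<lambda>n. c * x ^ n)"
proof -
  have "(cmod x)\<^sup>2 < 1" using assms by (simp add: power_less_one_iff abs_square_less_1)
  then have "summable (\<lambda>n. (cmod c)\<^sup>2 * ((cmod x)\<^sup>2) ^ n)"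
    by (intro summable_mult summable_geometric) simp
  then show ?thesis
    by (simp add: sq_summable_def norm_mult norm_power power_mult_distrib mult.commute flip: power_mult)
qed

lemma hardy2_diff_szego_sum:
  assumes f: "f \<in> hardy2" and l: "\<And>n. n \<in> A \<Longrightarrow> cmod (l n) < 1"
  shows "(\<lambda>z. f z - (\<Sum>n\<in>A. c n * szego_kernel (l n) z)) \<in> hardy2"
proof -
  have "sq_summable (\<lambda>i. taylor f i - (\<Sum>n\<in>A. c n * cnj (l n) ^ i))"
    using l
  proof (induction A rule: infinite_finite_induct)
    case (insert x A)
    have "sq_summable (\<lambda>i. (taylor f i - (\<Sum>n\<in>A. c n * cnj (l n) ^ i)) - c x * cnj (l x) ^ i)"
      by (intro l2norm_diff_le(1) insert.IH sq_summable_power) (use insert.prems in auto)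
    then show ?case using insert.hyps by (simp add: algebra_simps)
  qed (use f in \<open>auto simp: hardy2_iff\<close>)
  moreover have "(\<lambda>z. f z - (\<Sum>n\<in>A. c n * szego_kernel (l n) z)) holomorphic_on ball 0 1"
    using f l by (intro holomorphic_intros holomorphic_on_szego_kernel) (auto simp: hardy2_iff)
  ultimately show ?thesis
    using f by (simp add: hardy2_iff taylor_diff_szego_sum)
qed

lemma szego_kernel_in_hardy2:
  assumes "cmod l < 1"
  shows "szego_kernel l \<in> hardy2"
  using holomorphic_on_szego_kernel[OF assms] sq_summable_power[of "cnj l" 1] assms
  by (simp add: hardy2_iff fps_expansion_eqI[OF has_fps_expansion_szego_kernel] Abs_fps_inverse)

section \<open>The points on the circles of radius \<open>1 - 1/k\<close>\<close>

lemma triangular_index: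
  fixes n :: nat
  assumes "1 \<le> n"
  obtains k j where "1 \<le> k" "j < k" "n = k * (k - 1) div 2 + j + 1"
proof -
  have "\<exists>k j. 1 \<le> k \<and> j < k \<and> n = k * (k - 1) div 2 + j + 1"
    using assms
  proof (induction n rule: dec_induct)
    case base
    show ?case by (intro exI[of _ 1] exI[of _ 0]) simp
  next
    case (step n)
    then obtain k j where kj: "1 \<le> k" "j < k" "n = k * (k - 1) div 2 + j + 1" by blast
    show ?case
    proof (cases "Suc j < k")
      case True
      with kj show ?thesis by (intro exI[of _ k] exI[of _ "Suc j"]) simp
    next
      case False
      have "Suc k * (Suc k - 1) div 2 = k * (k - 1) div 2 + k"
      proof (cases k)
        case (Suc l)
        have "(Suc (Suc l) * Suc l) div 2 = (Suc l * l + Suc l * 2) div 2" by (simp add: algebra_simps)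
        then show ?thesis using Suc by simp
      qed simp
      with kj False show ?thesis by (intro exI[of _ "Suc k"] exI[of _ 0]) auto
    qed
  qed
  then show ?thesis using that by blast
qed

text \<open>
  Over a full turn \<open>k\<close> the radius decays by a definite factor, \<open>(1 - 1/k) ^ k \<le> exp (- 1)\<close>, while over half
  of it Bernoulli's inequality shows that at least one half survives.
\<close>

lemma radius_power_bounds:
  fixes k :: nat
  assumes "2 \<le> k"
  shows "(1 - 1 / real k) ^ k \<le> 1 / 2" "1 / 2 \<le> (1 - 1 / real k) ^ (k div 2)"
proof -
  have "(1 - 1 / real k) ^ k \<le> exp (- 1 / real k) ^ k"
    using exp_ge_add_one_self[of "- 1 / real k"] assms by (intro power_mono) auto
  also have "\<dots> = exp (- 1)" using assms by (simp flip: exp_of_nat_mult)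
  also have "\<dots> \<le> 1 / 2"
    using exp_ge_add_one_self[of 1] by (simp add: exp_minus field_simps)
  finally show "(1 - 1 / real k) ^ k \<le> 1 / 2" .
  have "real (k div 2) \<le> real k / 2" by linarith
  then have "1 / 2 \<le> 1 + real (k div 2) * (- 1 / real k)"
    using assms by (simp add: field_simps)
  also have "\<dots> \<le> (1 + - 1 / real k) ^ (k div 2)"
    using assms by (intro Bernoulli_inequality) simp
  finally show "1 / 2 \<le> (1 - 1 / real k) ^ (k div 2)" by simp
qed

text \<open>The conjugate appears because the Taylor coefficients of a kernel are powers of the conjugate point.\<close>

lemma primitive_root_unity:
  assumes "0 < k"
  defines "v \<equiv> cnj (cis (2 * pi / real k))"
  shows "v ^ k = 1" "inj_on (\<lambda>i. v ^ i) {..<k}"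
proof -
  have pow: "v ^ i = cnj (cis (2 * pi * real i / real k))" for i
    by (simp add: v_def Complex.DeMoivre mult_ac flip: complex_cnj_power)
  show "v ^ k = 1" using assms(1) by (simp add: pow)
  have "inj_on (\<lambda>i. cis (2 * pi * real i / real k)) {..<k}"
    using Complex.bij_betw_roots_unity[OF assms(1)] by (simp add: bij_betw_def)
  then show "inj_on (\<lambda>i. v ^ i) {..<k}" by (simp add: inj_on_def pow)
qed

theorem theorem1:
  fixes lam :: "nat \<Rightarrow> complex"
  assumes "\<And>k j :: nat. 1 \<le> k \<Longrightarrow> j < k \<Longrightarrow>
    lam (k * (k - 1) div 2 + j + 1) =
      (1 - 1 / of_nat k) * exp (2 * of_real pi * \<i> * of_nat j / of_nat k)"
  shows "representing_system hardy2 hardy2_norm (\<lambda>n. szego_kernel (lam n))"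
proof -
  have cnj_lam: "cnj (lam (k * (k - 1) div 2 + j + 1)) =
      of_real (1 - 1 / real k) * cnj (cis (2 * pi / real k)) ^ j" if "1 \<le> k" "j < k" for k j
  proof -
    have "exp (2 * of_real pi * \<i> * of_nat j / of_nat k) = cis (2 * pi / real k) ^ j"
      by (simp add: cis_conv_exp mult_ac flip: exp_of_nat_mult)
    then show ?thesis using assms[OF that] by simp
  qed
  have lam: "cmod (lam n) < 1" if n: "1 \<le> n" for n
  proof -
    obtain k j where kj: "1 \<le> k" "j < k" "n = k * (k - 1) div 2 + j + 1"
      by (rule triangular_index[OF n])
    have "cmod (lam n) = cmod (cnj (lam n))" by simp
    also have "\<dots> = \<bar>1 - 1 / real k\<bar>"
      unfolding kj(3) cnj_lam[OF kj(1,2)] norm_mult norm_power complex_mod_cnj norm_cis norm_of_real by simp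
    also have "\<dots> < 1" using kj by simp
    finally show ?thesis .
  qed
  show ?thesis
  proof (rule representing_system_if_block_approximation[where q = "3/4" and C = 4])
    show "szego_kernel (lam n) \<in> hardy2" if "1 \<le> n" for n
      by (rule szego_kernel_in_hardy2[OF lam[OF that]])
    show "0 \<le> hardy2_norm f" if "f \<in> hardy2" for f
      using that by (simp add: hardy2_norm_eq_l2norm hardy2_iff l2norm_nonneg)
    show "(\<lambda>z. f z - (\<Sum>n\<in>A. c n * szego_kernel (lam n) z)) \<in> hardy2"
      if "f \<in> hardy2" "finite A" "0 \<notin> A" for f A c
    proof (rule hardy2_diff_szego_sum[OF that(1)])
      fix n assume "n \<in> A"
      with that(3) have "1 \<le> n" by (cases n) auto
      then show "cmod (lam n) < 1" by (rule lam)
    qed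
    fix f m assume f: "f \<in> hardy2"
    define a where "a = taylor f"
    have a: "sq_summable a" and holo: "f holomorphic_on ball 0 1"
      using f by (auto simp: hardy2_iff a_def)
    obtain D0 where D0: "\<And>D. D0 \<le> D \<Longrightarrow> sq_summable (\<lambda>n. if n < D then 0 else a n) \<and>
        l2norm (\<lambda>n. if n < D then 0 else a n) \<le> 1/10 * l2norm a"
      using l2norm_tail_le[OF a, of "1/10"] by auto
    \<comment> \<open>The group must start beyond \<open>m\<close>, and half its length must reach the place from which on the tail is small.\<close>
    define k where "k = 2 * D0 + m + 2"
    define s where "s = k * (k - 1) div 2"
    define v where "v = cnj (cis (2 * pi / real k))"
    have k: "2 \<le> k" "0 < k" "D0 \<le> k div 2" by (auto simp: k_def)
    have "m \<le> s"
    proof -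
      have "2 * (k - 1) \<le> k * (k - 1)" using k by (intro mult_right_mono) auto
      then have "2 * (k - 1) div 2 \<le> s" unfolding s_def by (rule div_le_mono)
      then show ?thesis by (simp add: k_def)
    qed
    have r: "0 < 1 - 1 / real k" "1 - 1 / real k \<le> 1" using k by auto
    obtain c where
      c: "l2norm (\<lambda>n. a n - (\<Sum>j<k. c j * (of_real (1 - 1 / real k) * v ^ j) ^ n)) \<le> 3/4 * l2norm a"
        "\<And>M. M \<le> k \<Longrightarrow> l2norm (\<lambda>n. a n - (\<Sum>j<M. c j * (of_real (1 - 1 / real k) * v ^ j) ^ n)) \<le> 4 * l2norm a"
      using block_approximation[OF k(2) primitive_root_unity[OF k(2)] a r
          radius_power_bounds(1)[OF k(1)] _ radius_power_bounds(2)[OF k(1)]] D0[OF k(3)]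
      unfolding v_def by auto
    define c' where "c' = (\<lambda>n. c (n - s - 1))"
    have N: "hardy2_norm (\<lambda>z. f z - (\<Sum>n\<in>{s<..s + M}. c' n * szego_kernel (lam n) z)) =
        l2norm (\<lambda>n. a n - (\<Sum>j<M. c j * (of_real (1 - 1 / real k) * v ^ j) ^ n))" if "M \<le> k" for M
    proof -
      have "(\<Sum>n\<in>{s<..s + M}. c' n * cnj (lam n) ^ i) =
          (\<Sum>j<M. c j * (of_real (1 - 1 / real k) * v ^ j) ^ i)" for i
      proof (rule sum.reindex_bij_witness[where i = "\<lambda>j. s + j + 1" and j = "\<lambda>n. n - s - 1"])
        fix n assume "n \<in> {s<..s + M}"
        then have n: "n = s + (n - s - 1) + 1" "n - s - 1 < k" using that by auto
        show "c (n - s - 1) * (of_real (1 - 1 / real k) * v ^ (n - s - 1)) ^ i = c' n * cnj (lam n) ^ i"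
          using cnj_lam[of k "n - s - 1"] n k by (simp add: c'_def v_def s_def)
      qed auto
      then show ?thesis
        by (simp add: hardy2_norm_eq_l2norm taylor_diff_szego_sum[OF holo] a_def)
    qed
    have "hardy2_norm (\<lambda>z. f z - (\<Sum>n\<in>{s<..M}. c' n * szego_kernel (lam n) z)) \<le> 4 * hardy2_norm f"
      if "M \<le> s + k" for M
    proof -
      have "{s<..M} = {s<..s + (M - s)}" by auto
      then show ?thesis
        using N[of "M - s"] c(2)[of "M - s"] that by (simp add: hardy2_norm_eq_l2norm a_def)
    qed
    moreover have "hardy2_norm (\<lambda>z. f z - (\<Sum>n\<in>{s<..s + k}. c' n * szego_kernel (lam n) z))
        \<le> 3/4 * hardy2_norm f"
      using N[of k] c(1) by (simp add: hardy2_norm_eq_l2norm a_def)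
    ultimately show "\<exists>s t c. m \<le> s \<and> s < t \<and>
        hardy2_norm (\<lambda>z. f z - (\<Sum>n\<in>{s<..t}. c n * szego_kernel (lam n) z)) \<le> 3/4 * hardy2_norm f \<and>
        (\<forall>M\<le>t. hardy2_norm (\<lambda>z. f z - (\<Sum>n\<in>{s<..M}. c n * szego_kernel (lam n) z)) \<le> 4 * hardy2_norm f)"
      using \<open>m \<le> s\<close> k by (intro exI[of _ s] exI[of _ "s + k"] exI[of _ c']) auto
  qed auto
qed

end
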